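(* The critical probability for dyadic tilings of the three-dimensional cube satisfies $p_c(3)\geq 1/8$.
   Context: A dyadic interval is an interval $[\frac{a}{2^i},\frac{a+1}{2^i}]$ with integers $i\ge 0$ and $0\le a<2^i$. An order-$n$ dyadic tile in dimension $3$ is a product of $3$ dyadic intervals having volume $2^{-n}$ (a subset of $[0,1]^3$). A tiling of $[0,1]^3$ is a set of tiles whose union is $[0,1]^3$ and whose interiors are pairwise disjoint. For $p\in[0,1]$ let each order-$n$ dyadic tile be available with probability $p$, independently of the others. $p_c(3)$ is the infimum of those $p\in[0,1]$ for which the probability that there exists a tiling of $[0,1]^3$ by available order-$n$ tiles tends to $1$ as $n\to\infty$. *)

theory Defs
  imports "HOL-Analysis.Analysis" "HOL-Probability.Probability" "HOL-Probability.Product_PMF"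
begin

definition dyadic_interval :: "real set \<Rightarrow> bool" where
  "dyadic_interval I \<longleftrightarrow>
     (\<exists>(i::nat) (a::nat). a < 2 ^ i \<and> I = {real a / 2 ^ i .. (real a + 1) / 2 ^ i})"

definition unit_cube :: "(real ^ 3) set" where
  "unit_cube = {x. \<forall>k. x $ k \<in> {0..1}}"

definition dyadic_tiles :: "nat \<Rightarrow> (real ^ 3) set set" where
  "dyadic_tiles n =
     {t. (\<exists>I. (\<forall>k. dyadic_interval (I k)) \<and> t = {x. \<forall>k. x $ k \<in> I k}) \<and>
         measure lborel t = 1 / 2 ^ n}"

definition tiling :: "(real ^ 3) set set \<Rightarrow> bool" where
  "tiling T \<longleftrightarrow>
     \<Union>T = unit_cube \<and> pairwise (\<lambda>s t. interior s \<inter> interior t = {}) T"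

lemma finite_dyadic_tiles: "finite (dyadic_tiles n)"
proof -
  define S where "S = (\<lambda>(i :: nat, a :: nat). {real a / 2 ^ i .. (real a + 1) / 2 ^ i}) `
      ({..n} \<times> {..<2 ^ n})"
  define F where "F = (\<lambda>I :: 3 \<Rightarrow> real set. {x :: real ^ 3. \<forall>k. x $ k \<in> I k})"
  have "finite S"
    unfolding S_def by simp
  then have "finite {I :: 3 \<Rightarrow> real set. \<forall>k. I k \<in> S}"
    using finite_PiE[of "UNIV :: 3 set" "\<lambda>_. S"] by (simp add: PiE_def Pi_def extensional_def)
  moreover have "dyadic_tiles n \<subseteq> F ` {I. \<forall>k. I k \<in> S}"
  proof
    fix t assume "t \<in> dyadic_tiles n"
    then obtain I where I: "\<And>k. dyadic_interval (I k)" and t: "t = F I"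
      and vol: "measure lborel t = 1 / 2 ^ n"
      unfolding dyadic_tiles_def F_def by blast
    from I have "\<forall>k. \<exists>i a. a < (2::nat) ^ i \<and> I k = {real a / 2 ^ i .. (real a + 1) / 2 ^ i}"
      unfolding dyadic_interval_def by blast
    then obtain i a where ia: "\<And>k. a k < (2::nat) ^ i k"
      "\<And>k. I k = {real (a k) / 2 ^ i k .. (real (a k) + 1) / 2 ^ i k}"
      by metis
    define l u :: "real ^ 3" where "l = (\<chi> k. real (a k) / 2 ^ i k)"
      and "u = (\<chi> k. (real (a k) + 1) / 2 ^ i k)"
    have t_box: "t = cbox l u"
      by (auto simp: t F_def ia(2) l_def u_def mem_box_cart)
    have "l $ k \<le> u $ k" for k
      by (simp add: l_def u_def divide_right_mono)
    then have "cbox l u \<noteq> {}"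
      by (simp add: interval_ne_empty_cart)
    then have "measure lborel t = (\<Prod>k\<in>UNIV. u $ k - l $ k)"
      unfolding t_box by (rule content_cbox_cart)
    also have "\<dots> = (\<Prod>k\<in>UNIV. 1 / 2 ^ i k)"
      by (simp add: l_def u_def diff_divide_distrib[symmetric])
    also have "\<dots> = 1 / 2 ^ (\<Sum>k\<in>UNIV. i k)"
      by (simp add: prod_dividef power_sum)
    finally have "(\<Sum>k\<in>UNIV. i k) = n"
      using vol by simp
    then have i_le: "i k \<le> n" for k
      by (metis finite_code iso_tuple_UNIV_I member_le_sum zero_le)
    have "a k < 2 ^ n" for k
      using ia(1)[of k] power_increasing[OF i_le[of k], of "2::nat"] by linarith
    with i_le have "I k \<in> S" for k
      unfolding S_def ia(2) by force
    with t show "t \<in> F ` {I. \<forall>k. I k \<in> S}"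
      by blast
  qed
  ultimately show ?thesis
    by (meson finite_imageI finite_subset)
qed

text \<open>\<^const>\<open>Pi_pmf\<close> is a product measure only over a finite index set, which
  \<open>finite_dyadic_tiles\<close> provides. A configuration maps each tile to whether it is available.\<close>

definition tile_config :: "nat \<Rightarrow> real \<Rightarrow> ((real ^ 3) set \<Rightarrow> bool) pmf" where
  "tile_config n p = Pi_pmf (dyadic_tiles n) False (\<lambda>_. bernoulli_pmf p)"

definition tiling_prob :: "nat \<Rightarrow> real \<Rightarrow> real" where
  "tiling_prob n p =
     measure_pmf.prob (tile_config n p)
       {\<omega>. \<exists>T. T \<subseteq> {t \<in> dyadic_tiles n. \<omega> t} \<and> tiling T}"

text \<open>The set below contains 1, since slabs of thickness \<open>1 / 2 ^ n\<close> tile the cube, so the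
  infimum is not a junk value.\<close>

definition critical_prob_3 :: real where
  "critical_prob_3 = Inf {p \<in> {0..1}. (\<lambda>n. tiling_prob n p) \<longlonglongrightarrow> 1}"

end

theory Submission
  imports Defs
begin

text \<open>
  The idea is to look only at the tiles that touch the bottom face of the cube. A tiling of the
  cube induces a tiling of that face by the footprints of those tiles, and a bottom tile is
  determined by its footprint, because the volume \<open>2\<^sup>-\<^sup>n\<close> fixes its height. The footprints need
  not have equal areas. In the plane, however, every dyadic tiling of a dyadic rectangle other than
  the trivial one splits along one of the two midlines, since a footprint of full width and one of
  full height would cross. This splitting is false in space, and it is the reason for passing
  to the face: the tiling of the face is obtained by repeated bisection.

  Call a dyadic rectangle \<^emph>\<open>coverable\<close> if the bottom tile above it is available, or if both
  its left and right halves, or both its lower and upper halves, are coverable. If the cube has a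
  tiling by available tiles, then the unit square is coverable (\<open>tiling_imp_coverable\<close>). On the
  other hand, opposite halves depend on disjoint sets of tiles, so the largest probability \<open>s\<close>
  that a rectangle is coverable obeys \<open>s \<le> p + 2 s\<^sup>2\<close> recursively. The number \<open>1/4\<close> is a fixed
  point of \<open>1/8 + 2 s\<^sup>2\<close>, so for \<open>p \<le> 1/8\<close> the probability of being coverable never exceeds
  \<open>1/4\<close> (\<open>prob_coverable_le\<close>), and the probability of a tiling does not tend to \<open>1\<close>.
\<close>

section \<open>Bottom tiles and bisection\<close>

definition dyadic :: "nat \<Rightarrow> nat \<Rightarrow> real set" where
  "dyadic i a = {real a / 2 ^ i .. (real a + 1) / 2 ^ i}"

definition dyadic_box :: "(3 \<Rightarrow> nat) \<Rightarrow> (3 \<Rightarrow> nat) \<Rightarrow> (real ^ 3) set" where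
  "dyadic_box e a = {x. \<forall>k. x $ k \<in> dyadic (e k) (a k)}"

definition bottom_tile :: "nat \<Rightarrow> nat \<Rightarrow> nat \<Rightarrow> nat \<Rightarrow> nat \<Rightarrow> (real ^ 3) set" where
  "bottom_tile d i a j b =
     {x. x $ 1 \<in> dyadic i a \<and> x $ 2 \<in> dyadic j b \<and> x $ 3 \<in> dyadic d 0}"

text \<open>The number \<open>d\<close> of bisections that remain before footprints reach area \<open>2\<^sup>-\<^sup>n\<close> is also
  the order of the height of the bottom tile over the rectangle, so one parameter serves both as
  recursion depth and as height.\<close>

fun coverable :: "nat \<Rightarrow> nat \<Rightarrow> nat \<Rightarrow> nat \<Rightarrow> nat \<Rightarrow> ((real ^ 3) set \<Rightarrow> bool) \<Rightarrow> bool" where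
  "coverable 0 i a j b \<omega> = \<omega> (bottom_tile 0 i a j b)"
| "coverable (Suc d) i a j b \<omega> =
     (\<omega> (bottom_tile (Suc d) i a j b) \<or>
      (coverable d (Suc i) (2 * a) j b \<omega> \<and> coverable d (Suc i) (2 * a + 1) j b \<omega>) \<or>
      (coverable d i a (Suc j) (2 * b) \<omega> \<and> coverable d i a (Suc j) (2 * b + 1) \<omega>))"

section \<open>Geometry of dyadic tiles\<close>

lemma dyadic_box_eq_cbox:
  "dyadic_box e a = cbox (\<chi> k. real (a k) / 2 ^ e k) (\<chi> k. (real (a k) + 1) / 2 ^ e k)"
  by (auto simp: dyadic_box_def dyadic_def mem_box_cart)

lemma interior_dyadic_box:
  "interior (dyadic_box e a) =
     {x. \<forall>k. real (a k) / 2 ^ e k < x $ k \<and> x $ k < (real (a k) + 1) / 2 ^ e k}"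
  unfolding dyadic_box_eq_cbox interior_cbox by (auto simp: mem_box_cart)

lemma measure_dyadic_box: "measure lborel (dyadic_box e a) = 1 / 2 ^ (\<Sum>k\<in>UNIV. e k)"
proof -
  have "measure lborel (dyadic_box e a) =
      (\<Prod>k\<in>UNIV. (real (a k) + 1) / 2 ^ e k - real (a k) / 2 ^ e k)"
    unfolding dyadic_box_eq_cbox
    by (subst content_cbox_cart) (auto simp: interval_ne_empty_cart divide_right_mono)
  also have "\<dots> = (\<Prod>k\<in>UNIV. 1 / 2 ^ e k)"
    by (simp add: diff_divide_distrib[symmetric])
  also have "\<dots> = 1 / 2 ^ (\<Sum>k\<in>UNIV. e k)"
    by (simp add: prod_dividef power_sum)
  finally show ?thesis .
qed

lemma dyadic_tileE:
  assumes "t \<in> dyadic_tiles n"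
  obtains e a where "t = dyadic_box e a" "\<And>k. a k < 2 ^ e k" "(\<Sum>k\<in>UNIV. e k) = n"
proof -
  obtain I where I: "\<And>k. dyadic_interval (I k)" and t: "t = {x. \<forall>k. x $ k \<in> I k}"
    and vol: "measure lborel t = 1 / 2 ^ n"
    using assms unfolding dyadic_tiles_def by blast
  have "\<forall>k. \<exists>i a. a < (2::nat) ^ i \<and> I k = dyadic i a"
    using I unfolding dyadic_interval_def dyadic_def by blast
  then obtain e a where ea: "\<And>k. a k < (2::nat) ^ e k" "\<And>k. I k = dyadic (e k) (a k)"
    by metis
  have tb: "t = dyadic_box e a"
    by (simp add: t ea(2) dyadic_box_def)
  have "(\<Sum>k\<in>UNIV. e k) = n"
    using vol by (simp add: tb measure_dyadic_box)
  with tb ea(1) show thesis by (rule that)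
qed

lemma bottom_tile_in_dyadic_tiles:
  assumes "a < 2 ^ i" "b < 2 ^ j"
  shows "bottom_tile d i a j b \<in> dyadic_tiles (d + i + j)"
proof -
  define e :: "3 \<Rightarrow> nat" where "e = (\<lambda>k. if k = 1 then i else if k = 2 then j else d)"
  define c :: "3 \<Rightarrow> nat" where "c = (\<lambda>k. if k = 1 then a else if k = 2 then b else 0)"
  have eq: "bottom_tile d i a j b = dyadic_box e c"
    by (auto simp: bottom_tile_def dyadic_box_def e_def c_def forall_3)
  have "(\<Sum>k\<in>UNIV. e k) = d + i + j"
    by (simp add: sum_3 e_def)
  then have "measure lborel (bottom_tile d i a j b) = 1 / 2 ^ (d + i + j)"
    unfolding eq measure_dyadic_box by simp
  moreover have "\<forall>k. dyadic_interval (dyadic (e k) (c k))"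
  proof
    fix k
    have "c k < 2 ^ e k"
      using assms by (simp add: c_def e_def)
    then show "dyadic_interval (dyadic (e k) (c k))"
      unfolding dyadic_interval_def dyadic_def by blast
  qed
  ultimately show ?thesis
    unfolding dyadic_tiles_def eq
    by (intro CollectI conjI exI[of _ "\<lambda>k. dyadic (e k) (c k)"]) (simp_all add: dyadic_box_def)
qed

text \<open>Midpoints of the finest dyadic cells serve as generic points: they never lie on the boundary
  of a tile, and which dyadic interval of a given order contains them is integer division.\<close>

lemma midpoint_in_dyadic:
  assumes "(real u + 1/2) / 2 ^ n \<in> dyadic i a" and "i \<le> n"
  shows "a = u div 2 ^ (n - i)"
proof -
  define m :: nat where "m = 2 ^ (n - i)"
  have n: "(2::real) ^ n = real m * 2 ^ i"
    using assms(2) by (simp add: m_def power_add[symmetric])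
  have refine: "x / 2 ^ i = x * real m / 2 ^ n" for x :: real
    unfolding n by (simp add: m_def)
  have "real a * real m \<le> real u + 1/2" "real u + 1/2 \<le> (real a + 1) * real m"
    using assms(1) by (simp_all add: dyadic_def refine divide_le_cancel)
  then have "2 * real (a * m) \<le> 2 * real u + 1" "2 * real u + 1 \<le> 2 * real ((a + 1) * m)"
    by (simp_all add: field_simps)
  then have "a * m \<le> u" "u < (a + 1) * m"
    by linarith+
  then show ?thesis
    unfolding m_def[symmetric] by (metis Suc_eq_plus1 div_nat_eqI mult.commute)
qed

lemma midpoint_interior_dyadic:
  assumes "i \<le> n"
  shows "real (u div 2 ^ (n - i)) / 2 ^ i < (real u + 1/2) / 2 ^ n"
    and "(real u + 1/2) / 2 ^ n < (real (u div 2 ^ (n - i)) + 1) / 2 ^ i"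
proof -
  define m :: nat where "m = 2 ^ (n - i)"
  have n: "(2::real) ^ n = real m * 2 ^ i"
    using assms by (simp add: m_def power_add[symmetric])
  have refine: "x / 2 ^ i = x * real m / 2 ^ n" for x :: real
    unfolding n by (simp add: m_def)
  have "m > 0" by (simp add: m_def)
  have "u div m * m \<le> u" "u + 1 \<le> (u div m + 1) * m"
    using \<open>m > 0\<close> dividend_less_div_times[of m u] by (simp_all add: algebra_simps)
  then have "real (u div m * m) \<le> real u" "real (u + 1) \<le> real ((u div m + 1) * m)"
    by (simp_all only: of_nat_le_iff)
  then have "real (u div m) * real m < real u + 1/2" "real u + 1/2 < (real (u div m) + 1) * real m"
    by (simp_all add: algebra_simps)
  then show "real (u div 2 ^ (n - i)) / 2 ^ i < (real u + 1/2) / 2 ^ n"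
    "(real u + 1/2) / 2 ^ n < (real (u div 2 ^ (n - i)) + 1) / 2 ^ i"
    unfolding refine m_def[symmetric] by (simp_all add: divide_less_cancel)
qed

lemma dyadic_order_inj:
  assumes "dyadic i a = dyadic i' a'"
  shows "i = i'"
proof -
  have "real a / 2 ^ i = real a' / 2 ^ i'" "(real a + 1) / 2 ^ i = (real a' + 1) / 2 ^ i'"
    using assms by (auto simp: dyadic_def Icc_eq_Icc divide_right_mono not_le field_simps)
  then have "(1::real) / 2 ^ i = 1 / 2 ^ i'"
    by (simp add: add_divide_distrib)
  then show ?thesis by simp
qed

lemma bottom_tile_order_inj:
  assumes "bottom_tile d i a j b = bottom_tile d' i' a' j' b'"
  shows "i = i' \<and> j = j'"
proof -
  have ne: "dyadic d 0 \<noteq> {}" "dyadic i a \<noteq> {}" "dyadic j b \<noteq> {}" for d i a j b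
    by (auto simp: dyadic_def divide_right_mono not_le)
  have proj1: "(\<lambda>x. x $ 1) ` bottom_tile d i a j b = dyadic i a" for d i a j b
  proof
    show "dyadic i a \<subseteq> (\<lambda>x. x $ 1) ` bottom_tile d i a j b"
    proof
      fix r assume "r \<in> dyadic i a"
      moreover obtain s t where "s \<in> dyadic j b" "t \<in> dyadic d 0"
        using ne by (meson ex_in_conv)
      ultimately show "r \<in> (\<lambda>x. x $ 1) ` bottom_tile d i a j b"
        by (intro image_eqI[of _ _ "vector [r, s, t]"]) (auto simp: bottom_tile_def)
    qed
  qed (auto simp: bottom_tile_def)
  have proj2: "(\<lambda>x. x $ 2) ` bottom_tile d i a j b = dyadic j b" for d i a j b
  proof
    show "dyadic j b \<subseteq> (\<lambda>x. x $ 2) ` bottom_tile d i a j b"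
    proof
      fix s assume "s \<in> dyadic j b"
      moreover obtain r t where "r \<in> dyadic i a" "t \<in> dyadic d 0"
        using ne by (meson ex_in_conv)
      ultimately show "s \<in> (\<lambda>x. x $ 2) ` bottom_tile d i a j b"
        by (intro image_eqI[of _ _ "vector [r, s, t]"]) (auto simp: bottom_tile_def)
    qed
  qed (auto simp: bottom_tile_def)
  have "dyadic i a = dyadic i' a'" "dyadic j b = dyadic j' b'"
    using proj1[of d i a j b] proj1[of d' i' a' j' b'] proj2[of d i a j b] proj2[of d' i' a' j' b']
      assms by simp_all
  then show ?thesis by (blast dest: dyadic_order_inj)
qed

section \<open>A tiling of the cube bisects the bottom face\<close>

text \<open>The planar fault line argument, on the grid of \<open>2\<^sup>n \<times> 2\<^sup>n\<close> cells. Here \<open>si u v\<close> and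
  \<open>sj u v\<close> are the orders of the footprint that covers the cell \<open>(u, v)\<close>, and \<open>same\<close> says
  that all cells of a footprint agree on them. If a cell \<open>(u1, v1)\<close> had a footprint as wide as
  the rectangle and \<open>(u2, v2)\<close> one as high, both would cover \<open>(u2, v1)\<close>, so they would be one
  and the same footprint, namely the whole rectangle.\<close>

lemma coverable_of_footprints:
  fixes si sj :: "nat \<Rightarrow> nat \<Rightarrow> nat"
  assumes le: "\<And>u v. u < 2 ^ n \<Longrightarrow> v < 2 ^ n \<Longrightarrow> si u v + sj u v \<le> n"
    and avail: "\<And>u v. u < 2 ^ n \<Longrightarrow> v < 2 ^ n \<Longrightarrow>
      \<omega> (bottom_tile (n - si u v - sj u v)
            (si u v) (u div 2 ^ (n - si u v)) (sj u v) (v div 2 ^ (n - sj u v)))"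
    and same: "\<And>u v u' v'. u < 2 ^ n \<Longrightarrow> v < 2 ^ n \<Longrightarrow> u' < 2 ^ n \<Longrightarrow> v' < 2 ^ n \<Longrightarrow>
      u' div 2 ^ (n - si u v) = u div 2 ^ (n - si u v) \<Longrightarrow>
      v' div 2 ^ (n - sj u v) = v div 2 ^ (n - sj u v) \<Longrightarrow>
      si u' v' = si u v \<and> sj u' v' = sj u v"
    and "d + i + j = n" "a < 2 ^ i" "b < 2 ^ j"
    and "\<And>u v. u < 2 ^ n \<Longrightarrow> v < 2 ^ n \<Longrightarrow> u div 2 ^ (n - i) = a \<Longrightarrow> v div 2 ^ (n - j) = b \<Longrightarrow>
      i \<le> si u v \<and> j \<le> sj u v"
  shows "coverable d i a j b \<omega>"
  using assms(4-7)
proof (induction d arbitrary: i a j b)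
  case (0 i a j b)
  define u v where "u = a * 2 ^ (n - i)" and "v = b * 2 ^ (n - j)"
  have "i \<le> n" "j \<le> n" using "0.prems"(1) by auto
  have uv: "u < 2 ^ n" "v < 2 ^ n"
    using mult_strict_right_mono[OF "0.prems"(2), of "2 ^ (n - i)"]
      mult_strict_right_mono[OF "0.prems"(3), of "2 ^ (n - j)"] \<open>i \<le> n\<close> \<open>j \<le> n\<close>
    by (simp_all add: u_def v_def power_add[symmetric])
  have ab: "u div 2 ^ (n - i) = a" "v div 2 ^ (n - j) = b"
    by (simp_all add: u_def v_def)
  have "si u v = i" "sj u v = j"
    using "0.prems"(4)[OF uv ab] le[OF uv] "0.prems"(1) by auto
  then show ?case
    using avail[OF uv] ab "0.prems"(1) by auto
next
  case (Suc d i a j b)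
  define R where "R u v \<longleftrightarrow> u < 2 ^ n \<and> v < 2 ^ n \<and> u div 2 ^ (n - i) = a \<and> v div 2 ^ (n - j) = b"
    for u v
  have ge: "i \<le> si u v" "j \<le> sj u v" if "R u v" for u v
    using Suc.prems(4) that by (auto simp: R_def)
  have child: "u div 2 ^ (n - k) = c"
    if "u div 2 ^ (n - Suc k) = 2 * c + r" "r < 2" "Suc k \<le> n" for u k c r :: nat
  proof -
    have "n - k = (n - Suc k) + 1" using that(3) by simp
    then have "u div 2 ^ (n - k) = u div 2 ^ (n - Suc k) div 2"
      by (simp only: power_add power_one_right div_mult2_eq)
    then show ?thesis using that(1,2) by simp
  qed
  consider (whole) u v where "R u v" "si u v = i" "sj u v = j"
    | (vertical) "\<And>u v. R u v \<Longrightarrow> Suc i \<le> si u v"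
    | (horizontal) "\<And>u v. R u v \<Longrightarrow> Suc j \<le> sj u v"
  proof -
    have False if 1: "R u1 v1" "si u1 v1 = i" "sj u1 v1 \<noteq> j"
      and 2: "R u2 v2" "sj u2 v2 = j" for u1 v1 u2 v2
    proof -
      have "sj u2 v1 = sj u1 v1" "sj u2 v1 = sj u2 v2"
        using same[of u1 v1 u2 v1] same[of u2 v2 u2 v1] 1 2 by (auto simp: R_def)
      then show False using 1 2 by simp
    qed
    then show ?thesis
      using that ge by (metis Suc_leI le_neq_implies_less)
  qed
  then show ?case
  proof cases
    case whole
    then show ?thesis
      using avail[of u v] Suc.prems(1) by (auto simp: R_def)
  next
    case vertical
    have "coverable d (Suc i) (2 * a + r) j b \<omega>" if "r < 2" for r
    proof (rule Suc.IH)
      show "2 * a + r < 2 ^ Suc i" using Suc.prems(2) that by simp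
      fix u v assume "u < 2 ^ n" "v < 2 ^ n" "u div 2 ^ (n - Suc i) = 2 * a + r"
        "v div 2 ^ (n - j) = b"
      moreover from this have "R u v"
        using child[of u i a r] that Suc.prems(1) by (auto simp: R_def)
      ultimately show "Suc i \<le> si u v \<and> j \<le> sj u v" using vertical ge by blast
    qed (use Suc.prems in auto)
    from this[of 0] this[of 1] show ?thesis by simp
  next
    case horizontal
    have "coverable d i a (Suc j) (2 * b + r) \<omega>" if "r < 2" for r
    proof (rule Suc.IH)
      show "2 * b + r < 2 ^ Suc j" using Suc.prems(3) that by simp
      fix u v assume "u < 2 ^ n" "v < 2 ^ n" "u div 2 ^ (n - i) = a"
        "v div 2 ^ (n - Suc j) = 2 * b + r"
      moreover from this have "R u v"
        using child[of v j b r] that Suc.prems(1) by (auto simp: R_def)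
      ultimately show "i \<le> si u v \<and> Suc j \<le> sj u v" using horizontal ge by blast
    qed (use Suc.prems in auto)
    from this[of 0] this[of 1] show ?thesis by simp
  qed
qed

lemma tiling_imp_coverable:
  assumes T: "T \<subseteq> {t \<in> dyadic_tiles n. \<omega> t}" and tiling: "tiling T"
  shows "coverable n 0 0 0 0 \<omega>"
proof -
  \<comment> \<open>the midpoint of the bottom cell of side \<open>2\<^sup>-\<^sup>n\<close> over the grid cell \<open>(u, v)\<close>\<close>
  define P :: "nat \<Rightarrow> nat \<Rightarrow> real ^ 3" where
    "P u v = vector [(real u + 1/2) / 2 ^ n, (real v + 1/2) / 2 ^ n, (real 0 + 1/2) / 2 ^ n]" for u v
  define tl where "tl i j u v =
    bottom_tile (n - i - j) i (u div 2 ^ (n - i)) j (v div 2 ^ (n - j))" for i j u v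
  have ex: "\<exists>i j. i + j \<le> n \<and> tl i j u v \<in> T" if uv: "u < 2 ^ n" "v < 2 ^ n" for u v
  proof -
    have "real u + 1 \<le> 2 ^ n" "real v + 1 \<le> 2 ^ n"
      using uv by (metis Suc_leI of_nat_Suc of_nat_le_iff of_nat_numeral of_nat_power add.commute)+
    moreover have "(1::real) \<le> 2 ^ n" by simp
    ultimately have "P u v \<in> unit_cube"
      by (simp add: unit_cube_def forall_3 P_def field_simps)
    then obtain t where t: "t \<in> T" "P u v \<in> t"
      using tiling unfolding tiling_def by blast
    then obtain e a where ea: "t = dyadic_box e a" "(\<Sum>k\<in>UNIV. e k) = n"
      using T by (blast elim: dyadic_tileE)
    have n: "e 1 + e 2 + e 3 = n" using ea(2) by (simp add: sum_3)
    have mem: "(real u + 1/2) / 2 ^ n \<in> dyadic (e 1) (a 1)"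
        "(real v + 1/2) / 2 ^ n \<in> dyadic (e 2) (a 2)"
        "(real 0 + 1/2) / 2 ^ n \<in> dyadic (e 3) (a 3)"
      using t(2) unfolding ea(1) dyadic_box_def P_def by (simp_all add: forall_3)
    have a: "a 1 = u div 2 ^ (n - e 1)" "a 2 = v div 2 ^ (n - e 2)" "a 3 = 0"
      using mem[THEN midpoint_in_dyadic] n by auto
    have "n - e 1 - e 2 = e 3" using n by simp
    then have "t = tl (e 1) (e 2) u v"
      unfolding ea(1) dyadic_box_def tl_def bottom_tile_def by (simp add: forall_3 a)
    then show ?thesis using t(1) n by (intro exI[of _ "e 1"] exI[of _ "e 2"]) auto
  qed
  have P_interior: "P u v \<in> interior (tl i j u v)" if "i + j \<le> n" for i j u v
  proof -
    define e :: "3 \<Rightarrow> nat" where "e = (\<lambda>k. if k = 1 then i else if k = 2 then j else n - i - j)"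
    define c :: "3 \<Rightarrow> nat" where
      "c = (\<lambda>k. if k = 1 then u div 2 ^ (n - i) else if k = 2 then v div 2 ^ (n - j) else 0)"
    have "tl i j u v = dyadic_box e c"
      by (auto simp: tl_def bottom_tile_def dyadic_box_def e_def c_def forall_3)
    then show ?thesis
      using midpoint_interior_dyadic[of i n u] midpoint_interior_dyadic[of j n v]
        midpoint_interior_dyadic[of "n - i - j" n 0] that
      by (simp add: interior_dyadic_box forall_3 P_def e_def c_def)
  qed
  have unique: "i = i' \<and> j = j'"
    if "i + j \<le> n" "tl i j u v \<in> T" "i' + j' \<le> n" "tl i' j' u v \<in> T" for i j i' j' u v
  proof -
    have "interior (tl i j u v) \<inter> interior (tl i' j' u v) \<noteq> {}"
      using P_interior[of i j u v] P_interior[of i' j' u v] that by blast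
    then have "tl i j u v = tl i' j' u v"
      using tiling that unfolding tiling_def pairwise_def by blast
    then show ?thesis unfolding tl_def by (rule bottom_tile_order_inj)
  qed
  have "\<forall>u v. \<exists>i j. u < 2 ^ n \<longrightarrow> v < 2 ^ n \<longrightarrow> i + j \<le> n \<and> tl i j u v \<in> T"
    using ex by blast
  then obtain si sj where s: "\<And>u v. u < 2 ^ n \<Longrightarrow> v < 2 ^ n \<Longrightarrow>
      si u v + sj u v \<le> n \<and> tl (si u v) (sj u v) u v \<in> T"
    by metis
  show ?thesis
  proof (rule coverable_of_footprints[where si = si and sj = sj and n = n])
    fix u v :: nat assume uv: "u < 2 ^ n" "v < 2 ^ n"
    show "si u v + sj u v \<le> n" using s[OF uv] by simp
    show "\<omega> (bottom_tile (n - si u v - sj u v)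
            (si u v) (u div 2 ^ (n - si u v)) (sj u v) (v div 2 ^ (n - sj u v)))"
      using s[OF uv] T unfolding tl_def by blast
    fix u' v' :: nat assume uv': "u' < 2 ^ n" "v' < 2 ^ n"
      "u' div 2 ^ (n - si u v) = u div 2 ^ (n - si u v)"
      "v' div 2 ^ (n - sj u v) = v div 2 ^ (n - sj u v)"
    then have "tl (si u v) (sj u v) u' v' = tl (si u v) (sj u v) u v"
      by (simp add: tl_def)
    then show "si u' v' = si u v \<and> sj u' v' = sj u v"
      using s[OF uv] s[OF uv'(1,2)] unique[of "si u' v'" "sj u' v'" u' v' "si u v" "sj u v"] by simp
  qed auto
qed

section \<open>Opposite halves are independent\<close>

lemma Pi_pmf_prob_conj_indep:
  assumes fin: "finite I" and A: "A \<subseteq> I"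
    and P: "\<And>f g. (\<And>x. x \<in> A \<Longrightarrow> f x = g x) \<Longrightarrow> P f = P g"
    and Q: "\<And>f g. (\<And>x. x \<in> I - A \<Longrightarrow> f x = g x) \<Longrightarrow> Q f = Q g"
  shows "measure_pmf.prob (Pi_pmf I dflt p) {f. P f \<and> Q f} =
    measure_pmf.prob (Pi_pmf I dflt p) {f. P f} * measure_pmf.prob (Pi_pmf I dflt p) {f. Q f}"
proof -
  let ?M = "Pi_pmf A dflt p" and ?N = "Pi_pmf (I - A) dflt p"
  let ?h = "\<lambda>(f, g) x. if x \<in> A then f x else g x"
  have "Pi_pmf (A \<union> (I - A)) dflt p = map_pmf ?h (pair_pmf ?M ?N)"
    using fin A by (intro Pi_pmf_union) (auto intro: finite_subset)
  then have eq: "Pi_pmf I dflt p = map_pmf ?h (pair_pmf ?M ?N)"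
    using A by (simp add: Un_absorb1)
  have PQ: "P (?h fg) = P (fst fg)" "Q (?h fg) = Q (snd fg)" for fg
    by (cases fg; intro P Q; simp)+
  have prod: "measure_pmf.prob (pair_pmf ?M ?N) (X \<times> Y) =
      measure_pmf.prob ?M X * measure_pmf.prob ?N Y" for X Y
  proof -
    have "measure_pmf.prob (pair_pmf ?M ?N) (X \<times> Y) =
        measure_pmf.prob (pair_pmf ?M ?N) ((X \<inter> set_pmf ?M) \<times> (Y \<inter> set_pmf ?N))"
      by (rule measure_prob_cong_0) (auto simp: pmf_pair pmf_eq_0_set_pmf)
    also have "\<dots> = measure_pmf.prob ?M (X \<inter> set_pmf ?M) * measure_pmf.prob ?N (Y \<inter> set_pmf ?N)"
      by (intro measure_pmf_prob_product) auto
    finally show ?thesis by (simp add: measure_Int_set_pmf)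
  qed
  have sets: "?h -` {f. P f \<and> Q f} = {f. P f} \<times> {g. Q g}"
    "?h -` {f. P f} = {f. P f} \<times> UNIV" "?h -` {f. Q f} = UNIV \<times> {g. Q g}"
    unfolding vimage_def mem_Collect_eq PQ by auto
  show ?thesis
    unfolding eq measure_map_pmf sets prod by simp
qed

definition tiles_over :: "nat \<Rightarrow> nat \<Rightarrow> nat \<Rightarrow> nat \<Rightarrow> nat \<Rightarrow> (real ^ 3) set set" where
  "tiles_over n i a j b =
     {t \<in> dyadic_tiles n. \<forall>x\<in>t. x $ 1 \<in> dyadic i a \<and> x $ 2 \<in> dyadic j b}"

lemma dyadic_halves: "dyadic (Suc i) (2 * a) \<subseteq> dyadic i a" "dyadic (Suc i) (2 * a + 1) \<subseteq> dyadic i a"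
  by (auto simp: dyadic_def field_simps)

lemma coverable_cong:
  assumes "d + i + j = n" "a < 2 ^ i" "b < 2 ^ j"
    and "\<And>t. t \<in> tiles_over n i a j b \<Longrightarrow> \<omega> t = \<omega>' t"
  shows "coverable d i a j b \<omega> = coverable d i a j b \<omega>'"
  using assms
proof (induction d arbitrary: i a j b)
  case (0 i a j b)
  have "bottom_tile 0 i a j b \<in> tiles_over n i a j b"
    using bottom_tile_in_dyadic_tiles[of a i b j 0] 0
    by (auto simp: tiles_over_def bottom_tile_def)
  then show ?case using 0 by simp
next
  case (Suc d i a j b)
  have "bottom_tile (Suc d) i a j b \<in> tiles_over n i a j b"
    using bottom_tile_in_dyadic_tiles[of a i b j "Suc d"] Suc.prems
    by (auto simp: tiles_over_def bottom_tile_def)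
  then have "\<omega> (bottom_tile (Suc d) i a j b) = \<omega>' (bottom_tile (Suc d) i a j b)"
    using Suc.prems(4) by blast
  moreover have "coverable d (Suc i) c j b \<omega> = coverable d (Suc i) c j b \<omega>'"
    if "c = 2 * a \<or> c = 2 * a + 1" for c
  proof (rule Suc.IH)
    show "c < 2 ^ Suc i" using that Suc.prems(2) by auto
    show "\<omega> t = \<omega>' t" if "t \<in> tiles_over n (Suc i) c j b" for t
      using that \<open>c = 2 * a \<or> c = 2 * a + 1\<close> dyadic_halves[of i a]
      by (intro Suc.prems(4)) (auto simp: tiles_over_def)
  qed (use Suc.prems in auto)
  moreover have "coverable d i a (Suc j) c \<omega> = coverable d i a (Suc j) c \<omega>'"
    if "c = 2 * b \<or> c = 2 * b + 1" for c
  proof (rule Suc.IH)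
    show "c < 2 ^ Suc j" using that Suc.prems(3) by auto
    show "\<omega> t = \<omega>' t" if "t \<in> tiles_over n i a (Suc j) c" for t
      using that \<open>c = 2 * b \<or> c = 2 * b + 1\<close> dyadic_halves[of j b]
      by (intro Suc.prems(4)) (auto simp: tiles_over_def)
  qed (use Suc.prems in auto)
  ultimately show ?case by simp
qed

text \<open>A common tile of two opposite halves would be flat: both of its end points in the direction
  of the cut would lie on the midline.\<close>

lemma tiles_over_halves_disjoint:
  "tiles_over n (Suc i) (2 * a) j b \<inter> tiles_over n (Suc i) (2 * a + 1) j b = {}"
  "tiles_over n i a (Suc j) (2 * b) \<inter> tiles_over n i a (Suc j) (2 * b + 1) = {}"
proof -
  have flat: False if "t \<in> dyadic_tiles n"
    "\<And>x. x \<in> t \<Longrightarrow> x $ k \<in> dyadic (Suc i) (2 * a) \<inter> dyadic (Suc i) (2 * a + 1)" for t k i a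
  proof -
    obtain e c where t: "t = dyadic_box e c"
      using \<open>t \<in> dyadic_tiles n\<close> by (blast elim: dyadic_tileE)
    define l r :: "real ^ 3" where "l = (\<chi> k. real (c k) / 2 ^ e k)"
      and "r = (\<chi> k. (real (c k) + 1) / 2 ^ e k)"
    have lr: "l $ k < r $ k" for k by (simp add: l_def r_def divide_strict_right_mono)
    then have "l \<in> t" "r \<in> t"
      unfolding t dyadic_box_eq_cbox l_def[symmetric] r_def[symmetric]
      by (auto simp: mem_box_cart less_imp_le)
    then have "l $ k = real (2 * a + 1) / 2 ^ Suc i" "r $ k = real (2 * a + 1) / 2 ^ Suc i"
      using that(2)[of l] that(2)[of r] by (auto simp: dyadic_def add.commute)
    then show False using lr[of k] by simp
  qed
  show "tiles_over n (Suc i) (2 * a) j b \<inter> tiles_over n (Suc i) (2 * a + 1) j b = {}"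
    using flat[of _ 1 i a] unfolding tiles_over_def by blast
  show "tiles_over n i a (Suc j) (2 * b) \<inter> tiles_over n i a (Suc j) (2 * b + 1) = {}"
    using flat[of _ 2 j b] unfolding tiles_over_def by blast
qed

section \<open>The recursive bound\<close>

lemma prob_tile_available:
  assumes "0 \<le> p" "p \<le> 1" "t \<in> dyadic_tiles n"
  shows "measure_pmf.prob (tile_config n p) {\<omega>. \<omega> t} = p"
proof -
  have "measure_pmf.prob (tile_config n p) {\<omega>. \<omega> t} =
      measure_pmf.prob (map_pmf (\<lambda>\<omega>. \<omega> t) (tile_config n p)) {True}"
    by (simp add: measure_map_pmf vimage_def)
  also have "map_pmf (\<lambda>\<omega>. \<omega> t) (tile_config n p) = bernoulli_pmf p"
    using assms(3) by (simp add: tile_config_def Pi_pmf_component finite_dyadic_tiles)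
  finally show ?thesis
    using assms(1,2) by (simp add: measure_pmf_single)
qed

lemma prob_coverable_halves:
  assumes "d + i + j = n" "a < 2 ^ i" "b < 2 ^ j" and "d + i' + j' = n" "a' < 2 ^ i'" "b' < 2 ^ j'"
    and disj: "tiles_over n i a j b \<inter> tiles_over n i' a' j' b' = {}"
  shows "measure_pmf.prob (tile_config n p) {\<omega>. coverable d i a j b \<omega> \<and> coverable d i' a' j' b' \<omega>} =
    measure_pmf.prob (tile_config n p) {\<omega>. coverable d i a j b \<omega>} *
    measure_pmf.prob (tile_config n p) {\<omega>. coverable d i' a' j' b' \<omega>}"
  unfolding tile_config_def
proof (rule Pi_pmf_prob_conj_indep[OF finite_dyadic_tiles, where A = "tiles_over n i a j b"])
  show "tiles_over n i a j b \<subseteq> dyadic_tiles n"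
    by (auto simp: tiles_over_def)
  show "coverable d i a j b f = coverable d i a j b g"
    if "\<And>t. t \<in> tiles_over n i a j b \<Longrightarrow> f t = g t" for f g
    using assms(1-3) that by (rule coverable_cong)
  have "tiles_over n i' a' j' b' \<subseteq> dyadic_tiles n - tiles_over n i a j b"
    using disj by (auto simp: tiles_over_def)
  then show "coverable d i' a' j' b' f = coverable d i' a' j' b' g"
    if "\<And>t. t \<in> dyadic_tiles n - tiles_over n i a j b \<Longrightarrow> f t = g t" for f g
    using that by (intro coverable_cong[OF assms(4-6)]) blast
qed

text \<open>A union bound over the three ways to be coverable, with independence of opposite halves:
  \<open>1/8 + 1/16 + 1/16 = 1/4\<close>.\<close>

lemma prob_coverable_le:
  assumes p: "0 \<le> p" "p \<le> 1 / 8" and "d + i + j = n" "a < 2 ^ i" "b < 2 ^ j"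
  shows "measure_pmf.prob (tile_config n p) {\<omega>. coverable d i a j b \<omega>} \<le> 1 / 4"
  using assms(3-5)
proof (induction d arbitrary: i a j b)
  case (0 i a j b)
  then have "bottom_tile 0 i a j b \<in> dyadic_tiles n"
    using bottom_tile_in_dyadic_tiles[of a i b j 0] by simp
  then show ?case
    using prob_tile_available[of p "bottom_tile 0 i a j b" n] p by simp
next
  case (Suc d i a j b)
  let ?pr = "measure_pmf.prob (tile_config n p)"
  let ?t = "bottom_tile (Suc d) i a j b"
  let ?V = "{\<omega>. coverable d (Suc i) (2 * a) j b \<omega> \<and> coverable d (Suc i) (2 * a + 1) j b \<omega>}"
  let ?H = "{\<omega>. coverable d i a (Suc j) (2 * b) \<omega> \<and> coverable d i a (Suc j) (2 * b + 1) \<omega>}"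
  have "?t \<in> dyadic_tiles n"
    using bottom_tile_in_dyadic_tiles[of a i b j "Suc d"] Suc.prems by simp
  then have t: "?pr {\<omega>. \<omega> ?t} \<le> 1 / 8"
    using prob_tile_available[of p ?t n] p by simp
  have "?pr ?V = ?pr {\<omega>. coverable d (Suc i) (2 * a) j b \<omega>} *
      ?pr {\<omega>. coverable d (Suc i) (2 * a + 1) j b \<omega>}"
    using Suc.prems by (intro prob_coverable_halves tiles_over_halves_disjoint) auto
  also have "\<dots> \<le> 1 / 4 * (1 / 4)"
    using Suc.prems by (intro mult_mono Suc.IH) auto
  finally have V: "?pr ?V \<le> 1 / 16" by simp
  have "?pr ?H = ?pr {\<omega>. coverable d i a (Suc j) (2 * b) \<omega>} *
      ?pr {\<omega>. coverable d i a (Suc j) (2 * b + 1) \<omega>}"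
    using Suc.prems by (intro prob_coverable_halves tiles_over_halves_disjoint) auto
  also have "\<dots> \<le> 1 / 4 * (1 / 4)"
    using Suc.prems by (intro mult_mono Suc.IH) auto
  finally have H: "?pr ?H \<le> 1 / 16" by simp
  have "{\<omega>. coverable (Suc d) i a j b \<omega>} = {\<omega>. \<omega> ?t} \<union> (?V \<union> ?H)"
    by auto
  then have "?pr {\<omega>. coverable (Suc d) i a j b \<omega>} \<le> ?pr {\<omega>. \<omega> ?t} + (?pr ?V + ?pr ?H)"
    using measure_Un_le[of "{\<omega>. \<omega> ?t}" "measure_pmf (tile_config n p)" "?V \<union> ?H"]
      measure_Un_le[of ?V "measure_pmf (tile_config n p)" ?H] by simp
  then show ?case using t V H by simp
qed

lemma tiling_prob_le:
  assumes "0 \<le> p" "p \<le> 1 / 8"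
  shows "tiling_prob n p \<le> 1 / 4"
proof -
  have "tiling_prob n p \<le> measure_pmf.prob (tile_config n p) {\<omega>. coverable n 0 0 0 0 \<omega>}"
    unfolding tiling_prob_def
    by (intro measure_pmf.finite_measure_mono) (auto intro: tiling_imp_coverable)
  also have "\<dots> \<le> 1 / 4"
    using assms by (intro prob_coverable_le) auto
  finally show ?thesis .
qed

text \<open>The infimum of the empty set of reals is unspecified, so a value of \<open>p\<close> that belongs to the
  set is needed. At \<open>p = 1\<close> every tile is available, and the slabs parallel to the bottom
  face form a tiling.\<close>

lemma tiling_prob_1: "tiling_prob n 1 = 1"
proof -
  define e :: "3 \<Rightarrow> nat" where "e = (\<lambda>k. if k = 3 then n else 0)"
  define slab where "slab c = dyadic_box e (\<lambda>k. if k = 3 then c else 0)" for c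
  define T where "T = slab ` {..<2 ^ n}"
  have slab_eq: "slab c = {x. x $ 1 \<in> {0..1} \<and> x $ 2 \<in> {0..1} \<and> x $ 3 \<in> dyadic n c}" for c
    by (auto simp: slab_def dyadic_box_def e_def forall_3 dyadic_def)
  have tiles: "slab c \<in> dyadic_tiles n" if "c < 2 ^ n" for c
  proof -
    define a :: "3 \<Rightarrow> nat" where "a = (\<lambda>k. if k = 3 then c else 0)"
    have "dyadic_interval (dyadic (e k) (a k))" for k
    proof -
      have "a k < 2 ^ e k"
        using that by (simp add: a_def e_def)
      then show ?thesis
        unfolding dyadic_interval_def dyadic_def by blast
    qed
    moreover have "measure lborel (slab c) = 1 / 2 ^ n"
      unfolding slab_def measure_dyadic_box by (simp add: sum_3 e_def)
    ultimately show ?thesis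
      unfolding dyadic_tiles_def slab_def a_def
      by (intro CollectI conjI exI[of _ "\<lambda>k. dyadic (e k) (if k = 3 then c else 0)"])
        (auto simp: dyadic_box_def)
  qed
  have "\<Union>T = unit_cube"
  proof
    show "\<Union>T \<subseteq> unit_cube"
    proof
      fix x assume "x \<in> \<Union>T"
      then obtain c where c: "c < 2 ^ n" "x \<in> slab c" by (auto simp: T_def)
      have "real c + 1 \<le> 2 ^ n"
        using c(1) by (metis Suc_leI of_nat_Suc of_nat_le_iff of_nat_numeral of_nat_power add.commute)
      then have "(real c + 1) / 2 ^ n \<le> 1" "0 \<le> real c / 2 ^ n" by simp_all
      then show "x \<in> unit_cube"
        using c(2) unfolding slab_eq unit_cube_def dyadic_def forall_3 mem_Collect_eq atLeastAtMost_iff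
        by linarith
    qed
    show "unit_cube \<subseteq> \<Union>T"
    proof
      fix x :: "real ^ 3" assume "x \<in> unit_cube"
      then have x: "x $ 1 \<in> {0..1}" "x $ 2 \<in> {0..1}" "0 \<le> x $ 3" "x $ 3 \<le> 1"
        by (auto simp: unit_cube_def)
      \<comment> \<open>the top face belongs to the last slab, where the floor would be one too large\<close>
      obtain c where "c < 2 ^ n" "x $ 3 \<in> dyadic n c"
      proof (cases "x $ 3 = 1")
        case True
        show thesis
          by (rule that[of "2 ^ n - 1"]) (simp_all add: True dyadic_def)
      next
        case False
        define y where "y = x $ 3 * 2 ^ n"
        have y: "0 \<le> y" "y < 2 ^ n" using x False by (simp_all add: y_def)
        then have "real (nat \<lfloor>y\<rfloor>) \<le> y" "y < real (nat \<lfloor>y\<rfloor>) + 1" by linarith+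
        moreover from this(1) y(2) have "real (nat \<lfloor>y\<rfloor>) < real (2 ^ n)"
          unfolding of_nat_power of_nat_numeral by (rule order.strict_trans1)
        then have "nat \<lfloor>y\<rfloor> < 2 ^ n" by (simp only: of_nat_less_iff)
        ultimately show thesis
          by (intro that[of "nat \<lfloor>y\<rfloor>"]) (simp_all add: dyadic_def y_def field_simps)
      qed
      then show "x \<in> \<Union>T" using x by (auto simp: T_def slab_eq)
    qed
  qed
  moreover have "pairwise (\<lambda>s t. interior s \<inter> interior t = {}) T"
  proof -
    have sep: "interior (slab c) \<inter> interior (slab c') = {}" if "c < c'" for c c'
    proof -
      have "real c + 1 \<le> real c'" using that by linarith
      then have "(real c + 1) / 2 ^ n \<le> real c' / 2 ^ n" by (simp add: divide_right_mono)
      then show ?thesis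
        unfolding slab_def interior_dyadic_box e_def by (fastforce simp: forall_3)
    qed
    then have "interior (slab c) \<inter> interior (slab c') = {}" if "c \<noteq> c'" for c c'
      using that by (metis Int_commute linorder_neqE_nat)
    then show ?thesis
      unfolding T_def by (intro pairwise_imageI) metis
  qed
  ultimately have "tiling T" by (simp add: tiling_def)
  have "\<omega> t" if "\<omega> \<in> set_pmf (tile_config n 1)" "t \<in> dyadic_tiles n" for \<omega> t
  proof -
    have "\<omega> t \<in> set_pmf (bernoulli_pmf 1)"
      using that by (auto simp: tile_config_def set_Pi_pmf finite_dyadic_tiles PiE_dflt_def)
    then show ?thesis by (cases "\<omega> t") (simp_all add: set_pmf_eq)
  qed
  moreover have "T \<subseteq> dyadic_tiles n"
    using tiles by (auto simp only: T_def image_subset_iff lessThan_iff)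
  ultimately have "AE \<omega> in measure_pmf (tile_config n 1).
      \<exists>T. T \<subseteq> {t \<in> dyadic_tiles n. \<omega> t} \<and> tiling T"
    using \<open>tiling T\<close> unfolding AE_measure_pmf_iff by blast
  then show ?thesis
    unfolding tiling_prob_def by (subst measure_pmf.prob_eq_1) simp_all
qed

theorem mainTheorem4: "critical_prob_3 \<ge> 1 / 8"
  unfolding critical_prob_3_def
proof (rule cInf_greatest)
  show "{p \<in> {0..1}. (\<lambda>n. tiling_prob n p) \<longlonglongrightarrow> 1} \<noteq> {}"
    using tiling_prob_1 by (auto intro!: exI[of _ 1])
  fix p :: real assume p: "p \<in> {p \<in> {0..1}. (\<lambda>n. tiling_prob n p) \<longlonglongrightarrow> 1}"
  show "1 / 8 \<le> p"
  proof (rule ccontr)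
    assume "\<not> 1 / 8 \<le> p"
    then have "tiling_prob n p \<le> 1 / 4" for n
      using p by (intro tiling_prob_le) auto
    then have "(1::real) \<le> 1 / 4"
      using p by (intro LIMSEQ_le_const2[of "\<lambda>n. tiling_prob n p" 1]) auto
    then show False by simp
  qed
qed

end
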